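(* Let $X$ be a Peano continuum and let $f:X\to X$ be a cw-expansive homeomorphism. Then $f$ has sensitive dependence on initial conditions, i.e. $f$ has no weak sinks: there is no point $x\in X$ such that $W^s_\varepsilon(x)$ is a neighborhood of $x$ for every $\varepsilon>0$.
   Context: A Peano continuum is a compact, connected, locally connected metric space $(X,d)$ with more than one point. A homeomorphism $f:X\to X$ of a compact metric space is continuum-wise expansive (cw-expansive) if there is a constant $\alpha>0$ such that $\sup_{n\in\mathbb Z}\operatorname{diam} f^n(C)>\alpha$ for every continuum $C\subset X$ containing more than one point. For $\varepsilon>0$ and $x\in X$: $W^s_\varepsilon(x)=\{y\in X:\ d(f^n(x),f^n(y))\le\varepsilon \text{ for all } n\ge 0\}$. A point $x$ is a weak sink if $W^s_\varepsilon(x)$ is a neighborhood of $x$ for every $\varepsilon>0$; $f$ is said to have sensitive dependence on initial conditions if it has no weak sinks. *)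

theory Defs
  imports "HOL-Analysis.Analysis"
begin

definition peano_continuum :: "'a::metric_space set \<Rightarrow> bool" where
  "peano_continuum X \<longleftrightarrow> compact X \<and> connected X \<and> locally connected X
     \<and> (\<exists>x\<in>X. \<exists>y\<in>X. x \<noteq> y)"

definition zit :: "'a set \<Rightarrow> ('a \<Rightarrow> 'a) \<Rightarrow> int \<Rightarrow> 'a \<Rightarrow> 'a" where
  "zit X f n = (if n \<ge> 0 then f ^^ nat n else (inv_into X f) ^^ nat (- n))"

definition cw_expansive :: "'a::metric_space set \<Rightarrow> ('a \<Rightarrow> 'a) \<Rightarrow> bool" where
  "cw_expansive X f \<longleftrightarrow> (\<exists>\<alpha>>0. \<forall>C. C \<subseteq> X \<and> compact C \<and> connected C
        \<and> (\<exists>x\<in>C. \<exists>y\<in>C. x \<noteq> y) \<longrightarrow> (SUP n\<in>(UNIV::int set). diameter (zit X f n ` C)) > \<alpha>)"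

definition local_stable_set :: "'a::metric_space set \<Rightarrow> ('a \<Rightarrow> 'a) \<Rightarrow> real \<Rightarrow> 'a \<Rightarrow> 'a set" where
  "local_stable_set X f \<epsilon> x = {y\<in>X. \<forall>n::nat. dist ((f ^^ n) x) ((f ^^ n) y) \<le> \<epsilon>}"

definition nbhd_in :: "'a::topological_space set \<Rightarrow> 'a set \<Rightarrow> 'a \<Rightarrow> bool" where
  "nbhd_in X W x \<longleftrightarrow> (\<exists>U. openin (top_of_set X) U \<and> x \<in> U \<and> U \<subseteq> W)"

definition weak_sink :: "'a::metric_space set \<Rightarrow> ('a \<Rightarrow> 'a) \<Rightarrow> 'a \<Rightarrow> bool" where
  "weak_sink X f x \<longleftrightarrow> x \<in> X \<and> (\<forall>\<epsilon>>0. nbhd_in X (local_stable_set X f \<epsilon> x) x)"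

end

theory Submission
  imports Defs
begin

text \<open>
  Suppose x is a weak sink and c is half an expansivity constant. By compactness, every
  continuum containing points at distance \<open>\<gamma>\<close> is stretched beyond c within boundedly many
  (say N) steps forwards or backwards. Near x there are arbitrarily many points, all of whose
  forward orbits stay c-close to each other. Cover X by finitely many tiny continua and
  choose more points near x than there are pieces: for large n two of them, y and y', have their
  n-th preimages in one piece P. Cut the image of P after n steps down to a continuum A near x that
  contains y and a point at distance \<open>\<gamma>\<close> from it. If the backward iterates of A up to time n stay
  c-close to those of y, this contradicts the choice of N. Otherwise shrink A until the threshold c
  is attained exactly, at some time -i. As P is tiny, -i is far from -n as well, and at time -i the
  continuum has extent c but is not stretched beyond c for a long time, a contradiction again.
\<close>

section \<open>Continua: boundary bumping, limits superior and small covers\<close>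

text \<open>\<open>K\<close> is the component of \<open>p\<close> in the sublevel set
  \<open>S\<close>. By boundary bumping it reaches the relative frontier of \<open>S\<close>, where
  \<open>\<phi>\<close> equals \<open>c\<close> because \<open>{\<phi> < c}\<close> is relatively
  open. It serves twice: to cut a continuum at a prescribed distance, then at a prescribed amount of
  stretching.\<close>

lemma continuum_bumping:
  fixes B :: "'a::metric_space set" and \<phi> :: "'a \<Rightarrow> real"
  assumes B: "compact B" "connected B" and \<phi>: "continuous_on B \<phi>"
    and p: "p \<in> B" "\<phi> p \<le> c" and q: "q \<in> B" "c \<le> \<phi> q"
  obtains K y where "K \<subseteq> B" "compact K" "connected K" "p \<in> K" "y \<in> K" "\<phi> y = c"
    "\<And>z. z \<in> K \<Longrightarrow> \<phi> z \<le> c"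
proof (cases "\<forall>z\<in>B. \<phi> z \<le> c")
  case True
  \<comment> \<open>Here \<open>\<phi> q = c\<close>, so \<open>B\<close> itself serves. The other
    case makes \<open>S\<close> a proper subset of \<open>B\<close>, as boundary bumping
    requires.\<close>
  then show ?thesis
    using that[of B q] assms by force
next
  case False
  define S where "S = {z \<in> B. \<phi> z \<le> c}"
  define K where "K = connected_component_set S p"
  have clo: "closedin (top_of_set B) S"
    using continuous_closedin_preimage[OF \<phi>, of "{..c}"] by (simp add: S_def vimage_def Int_def)
  then have "compact S"
    using B closedin_compact by blast
  then have "compact K"
    unfolding K_def using closed_connected_component compact_eq_bounded_closed
    by (metis compact_Int_closed compact_imp_closed connected_component_subset inf.absorb_iff2)
  have pS: "p \<in> S"
    using p by (simp add: S_def)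
  have KS: "K \<subseteq> S"
    by (simp add: K_def connected_component_subset)
  have "S \<subseteq> B"
    by (auto simp: S_def)
  have "K \<inter> top_of_set B frontier_of S \<noteq> {}"
  proof (rule boundary_bumping_theorem_closed)
    show "compact_space (top_of_set B)"
      using B by (simp add: compact_space_subtopology)
    show "K \<in> connected_components_of (subtopology (top_of_set B) S)"
    proof -
      have "K = connected_component_of_set (top_of_set S) p"
        by (auto simp: K_def connected_component_def connected_component_of_def
            connectedin_subtopology)
      then show ?thesis
        using pS \<open>S \<subseteq> B\<close>
        by (simp add: connected_components_of_def subtopology_subtopology Int_absorb1)
    qed
    show "S \<noteq> topspace (top_of_set B)"
      using False by (auto simp: S_def)
  qed (use B clo in \<open>simp_all add: connected_space_subtopology Hausdorff_space_subtopology\<close>)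
  then obtain y where y: "y \<in> K" "y \<in> top_of_set B frontier_of S"
    by blast
  have "openin (top_of_set B) {z \<in> B. \<phi> z < c}"
    using continuous_openin_preimage_gen[OF \<phi>, of "{..<c}"] by (simp add: vimage_def Int_def)
  then have "{z \<in> B. \<phi> z < c} \<subseteq> top_of_set B interior_of S"
    by (intro interior_of_maximal) (auto simp: S_def)
  then have "\<phi> y = c"
    using y KS by (force simp: S_def frontier_of_def)
  show ?thesis
  proof
    show "K \<subseteq> B" "compact K" "y \<in> K" "\<phi> y = c"
      using KS \<open>S \<subseteq> B\<close> \<open>compact K\<close> y \<open>\<phi> y = c\<close> by auto
    show "connected K" "p \<in> K"
      using pS by (auto simp: K_def)
    show "\<phi> z \<le> c" if "z \<in> K" for z
      using that KS by (auto simp: S_def)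
  qed
qed

text \<open>The convergent selection \<open>a\<close> keeps the topological limit superior
  connected. If closed sets \<open>E'\<close> (containing \<open>l\<close>) and \<open>F'\<close>
  split \<open>L\<close>, separate them by open \<open>U\<close> and \<open>V\<close>. All late
  \<open>A n\<close> lie in \<open>U \<union> V\<close> and contain \<open>a n\<close> from
  \<open>U\<close>, so they miss \<open>V\<close>, and hence so does \<open>L\<close>.\<close>

lemma connected_limsup:
  fixes X :: "'a::metric_space set"
  assumes X: "compact X" and A: "\<And>n. A n \<subseteq> X" "\<And>n. connected (A n)"
    and a: "\<And>n. a n \<in> A n" "a \<longlonglongrightarrow> l"
  defines "L \<equiv> \<Inter>m. closure (\<Union>n\<in>{m..}. A n)"
  shows "L \<subseteq> X" "compact L" "connected L" "l \<in> L"
proof -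
  have "closure (\<Union>n\<in>{m..}. A n) \<subseteq> X" for m
    using A X by (intro closure_minimal) (auto simp: compact_imp_closed)
  then show "L \<subseteq> X"
    by (auto simp: L_def)
  moreover have "closed L"
    by (auto simp: L_def)
  ultimately show "compact L"
    using X by (metis compact_Int_closed inf.absorb_iff2)
  show "l \<in> L"
  proof -
    have "l \<in> closure (\<Union>n\<in>{m..}. A n)" for m
    proof (rule closed_sequentially[OF closed_closure])
      show "(\<lambda>n. a (n + m)) \<longlonglongrightarrow> l"
        using a(2) by (rule LIMSEQ_ignore_initial_segment)
      show "a (n + m) \<in> closure (\<Union>n\<in>{m..}. A n)" for n
        using a(1)[of "n + m"] by (intro subsetD[OF closure_subset] UN_I) auto
    qed
    then show ?thesis
      by (simp add: L_def)
  qed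
  show "connected L"
  proof (rule ccontr)
    assume "\<not> connected L"
    then obtain E F where EF: "closed E" "closed F" "L = E \<union> F" "E \<inter> F = {}" "E \<noteq> {}" "F \<noteq> {}"
      using connected_closed_set[OF \<open>closed L\<close>] by auto
    define E' F' where "E' = (if l \<in> E then E else F)" and "F' = (if l \<in> E then F else E)"
    have EF': "closed E'" "closed F'" "L = E' \<union> F'" "E' \<inter> F' = {}" "F' \<noteq> {}" "l \<in> E'"
      using EF \<open>l \<in> L\<close> by (auto simp: E'_def F'_def)
    obtain U V where UV: "open U" "open V" "E' \<subseteq> U" "F' \<subseteq> V" "U \<inter> V = {}"
      using t4_space[OF EF'(1,2,4)] by blast
    \<comment> \<open>Otherwise points of ever later \<open>A n\<close> outside
      \<open>U \<union> V\<close> accumulate, by compactness of \<open>X\<close>, at a point of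
      \<open>L\<close> outside \<open>U \<union> V\<close>.\<close>
    have "\<exists>m. \<forall>n\<ge>m. A n \<subseteq> U \<union> V"
    proof (rule ccontr)
      assume "\<nexists>m. \<forall>n\<ge>m. A n \<subseteq> U \<union> V"
      then have "\<forall>m. \<exists>z. \<exists>n\<ge>m. z \<in> A n - (U \<union> V)"
        by blast
      then obtain z where z: "\<And>m. \<exists>n\<ge>m. z m \<in> A n - (U \<union> V)"
        by metis
      have "\<forall>m. z m \<in> X"
        using z A by blast
      then obtain w r where r: "strict_mono (r :: nat \<Rightarrow> nat)" and w: "(z \<circ> r) \<longlonglongrightarrow> w"
        using X by (meson compact_imp_seq_compact seq_compactE)
      have "w \<in> closure (\<Union>n\<in>{m..}. A n)" for m
      proof (rule closed_sequentially[OF closed_closure])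
        show "(\<lambda>k. (z \<circ> r) (k + m)) \<longlonglongrightarrow> w"
          using w by (rule LIMSEQ_ignore_initial_segment)
        fix k
        obtain n where "n \<ge> r (k + m)" "z (r (k + m)) \<in> A n"
          using z by blast
        moreover have "r (k + m) \<ge> m"
          using seq_suble[OF r, of "k + m"] by simp
        ultimately show "(z \<circ> r) (k + m) \<in> closure (\<Union>n\<in>{m..}. A n)"
          by (intro subsetD[OF closure_subset] UN_I[of n]) auto
      qed
      then have "w \<in> L"
        by (simp add: L_def)
      moreover have "w \<in> - (U \<union> V)"
        using z UV by (intro closed_sequentially[OF _ _ w]) (auto simp: closed_Compl)
      ultimately show False
        using EF' UV by blast
    qed
    moreover have "\<forall>\<^sub>F n in sequentially. a n \<in> U"
      using topological_tendstoD[OF a(2) UV(1)] UV(3) EF'(6) by blast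
    ultimately obtain m where m: "\<And>n. n \<ge> m \<Longrightarrow> A n \<subseteq> U \<union> V \<and> a n \<in> U"
      unfolding eventually_sequentially by (metis le_trans nle_le)
    have "A n \<inter> V = {}" if "n \<ge> m" for n
    proof -
      have "U \<inter> A n = {} \<or> V \<inter> A n = {}"
        using A(2)[of n] UV m[OF that] connectedD[of "A n" U V] by blast
      then show ?thesis
        using a(1)[of n] m[OF that] by blast
    qed
    then have "V \<inter> closure (\<Union>n\<in>{m..}. A n) = {}"
      using UV(2) by (subst open_Int_closure_eq_empty) auto
    moreover have "L \<subseteq> closure (\<Union>n\<in>{m..}. A n)"
      by (auto simp: L_def)
    ultimately show False
      using EF' UV by blast
  qed
qed

text \<open>
  Smallness is measured by the distance to a base point rather than by the diameter because the
  base points converge, so the bound passes to the topological limsup; two arbitrary points of the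
  limsup may come from disjoint subsequences, so a bound on the diameters would not.
\<close>
lemma separation_times_bounded:
  fixes X :: "'a::metric_space set" and h :: "int \<Rightarrow> 'a \<Rightarrow> 'b::metric_space"
  assumes X: "compact X" and h: "\<And>j. continuous_on X (h j)"
    and no_small: "\<And>C a b. \<lbrakk>C \<subseteq> X; compact C; connected C; a \<in> C; b \<in> C; a \<noteq> b;
      \<And>j z. z \<in> C \<Longrightarrow> dist (h j a) (h j z) \<le> c\<rbrakk> \<Longrightarrow> False"
    and "\<gamma> > 0"
  shows "\<exists>N::nat. \<forall>C a b. C \<subseteq> X \<and> connected C \<and> a \<in> C \<and> b \<in> C \<and> \<gamma> \<le> dist a b \<longrightarrow>
      (\<exists>j. \<exists>z\<in>C. \<bar>j\<bar> \<le> int N \<and> c < dist (h j a) (h j z))"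
proof (rule ccontr)
  \<comment> \<open>Take a counterexample for every \<open>N\<close> and pass to a subsequence along
    which both marked points converge. The limit superior is a nondegenerate continuum staying
    \<open>c\<close>-close to its base point at all times, against \<open>no_small\<close>.\<close>
  assume "\<not> ?thesis"
  then have "\<forall>N. \<exists>C a b. C \<subseteq> X \<and> connected C \<and> a \<in> C \<and> b \<in> C \<and> \<gamma> \<le> dist a b \<and>
      (\<forall>j z. \<bar>j\<bar> \<le> int N \<and> z \<in> C \<longrightarrow> dist (h j a) (h j z) \<le> c)"
    by (meson not_less)
  then obtain C a b where C: "\<And>N. C N \<subseteq> X" "\<And>N. connected (C N)"
    and ab: "\<And>N. a N \<in> C N" "\<And>N. b N \<in> C N" "\<And>N. \<gamma> \<le> dist (a N) (b N)"
    and small: "\<And>N j z. \<bar>j\<bar> \<le> int N \<Longrightarrow> z \<in> C N \<Longrightarrow> dist (h j (a N)) (h j z) \<le> c"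
    by metis
  have "seq_compact (X \<times> X)"
    using X by (simp add: compact_Times compact_imp_seq_compact)
  moreover have "\<forall>N. (a N, b N) \<in> X \<times> X"
    using ab C by blast
  ultimately obtain p r where r: "strict_mono (r :: nat \<Rightarrow> nat)"
    and "((\<lambda>N. (a N, b N)) \<circ> r) \<longlonglongrightarrow> p"
    by (meson seq_compactE)
  from tendsto_fst[OF this(2)] tendsto_snd[OF this(2)]
  have lim: "(a \<circ> r) \<longlonglongrightarrow> fst p" "(b \<circ> r) \<longlonglongrightarrow> snd p"
    by (simp_all add: o_def)
  define L where "L = (\<Inter>m. closure (\<Union>n\<in>{m..}. (C \<circ> r) n))"
  have La: "L \<subseteq> X" "compact L" "connected L" "fst p \<in> L"
    unfolding L_def using C ab by (intro connected_limsup[OF X _ _ _ lim(1)]; simp)+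
  have Lb: "snd p \<in> L"
    unfolding L_def using C ab by (intro connected_limsup(4)[OF X _ _ _ lim(2)]; simp)
  have "\<gamma> \<le> dist (fst p) (snd p)"
    using ab by (intro tendsto_le[OF _ tendsto_dist[OF lim] tendsto_const]) auto
  then have "fst p \<noteq> snd p"
    using \<open>\<gamma> > 0\<close> by auto
  then show False
  proof (rule no_small[OF La Lb])
    fix j z
    assume "z \<in> L"
    then have "z \<in> X"
      using La by blast
    \<comment> \<open>\<open>z\<close> is a limit of points \<open>w m\<close> of
      \<open>C (r (s m))\<close>. As \<open>s\<close> tends to infinity, the base points with the
      same indices tend to \<open>fst p\<close>.\<close>
    have "\<exists>w. w \<in> (\<Union>n\<in>{m..}. C (r n)) \<and> dist w z < inverse (real (Suc m))" for m
    proof -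
      have "z \<in> closure (\<Union>n\<in>{m..}. C (r n))"
        using \<open>z \<in> L\<close> by (simp add: L_def)
      then show ?thesis
        unfolding closure_approachable by (meson inverse_positive_iff_positive of_nat_0_less_iff zero_less_Suc)
    qed
    then obtain w where w: "\<And>m. w m \<in> (\<Union>n\<in>{m..}. C (r n))"
      "\<And>m. dist (w m) z < inverse (real (Suc m))"
      by metis
    then have "\<forall>m. \<exists>k. k \<ge> m \<and> w m \<in> C (r k)"
      by blast
    then obtain s where s: "\<And>m. s m \<ge> m" "\<And>m. w m \<in> C (r (s m))"
      by metis
    have wX: "w m \<in> X" for m
      using s C by blast
    have "w \<longlonglongrightarrow> z"
    proof (rule metric_LIMSEQ_I)
      fix e :: real assume "e > 0"
      then obtain M where "inverse (real (Suc M)) < e"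
        using reals_Archimedean by blast
      then have "dist (w m) z < e" if "m \<ge> M" for m
        using w(2)[of m] that by (smt (verit) inverse_le_iff_le of_nat_0_less_iff of_nat_mono Suc_le_mono zero_less_Suc)
      then show "\<exists>M. \<forall>m\<ge>M. dist (w m) z < e"
        by blast
    qed
    then have lz: "(\<lambda>m. h j (w m)) \<longlonglongrightarrow> h j z"
      using h[of j] \<open>z \<in> X\<close> wX by (simp add: continuous_on_sequentially o_def)
    have "filterlim s at_top sequentially"
      using s by (intro filterlim_at_top_mono[OF filterlim_ident]) auto
    from filterlim_compose[OF lim(1) this]
    have "(\<lambda>m. a (r (s m))) \<longlonglongrightarrow> fst p"
      by (simp add: o_def)
    moreover have "\<And>m. a (r (s m)) \<in> X"
      using ab C by blast
    ultimately have la: "(\<lambda>m. h j (a (r (s m)))) \<longlonglongrightarrow> h j (fst p)"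
      using h[of j] La by (auto simp: continuous_on_sequentially o_def)
    \<comment> \<open>Since \<open>r (s m) \<ge> s m \<ge> m\<close>, time \<open>j\<close> lies in
      the window of that counterexample.\<close>
    have "dist (h j (a (r (s m)))) (h j (w m)) \<le> c" if "m \<ge> nat \<bar>j\<bar>" for m
      using that s(1)[of m] seq_suble[OF r, of "s m"] by (intro small s) auto
    then show "dist (h j (fst p)) (h j z) \<le> c"
      by (intro tendsto_upperbound[OF tendsto_dist[OF la lz]])
        (auto simp: eventually_sequentially)
  qed
qed

text \<open>The pieces are closures of connected, relatively open sets. Radius
  \<open>\<delta>/3\<close> leaves room for the closure: two points of a closed ball of that radius
  are at most \<open>2\<delta>/3\<close> apart.\<close>

lemma locally_connected_compact_finite_cover:
  fixes X :: "'a::metric_space set"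
  assumes X: "compact X" "locally connected X" and "\<delta> > 0"
  obtains \<P> where "finite \<P>" "X \<subseteq> \<Union>\<P>"
    "\<And>P. P \<in> \<P> \<Longrightarrow> P \<subseteq> X \<and> compact P \<and> connected P \<and> (\<forall>u\<in>P. \<forall>v\<in>P. dist u v < \<delta>)"
proof -
  have "\<exists>T. open T \<and> x \<in> T \<and> connected (X \<inter> T) \<and> X \<inter> T \<subseteq> ball x (\<delta>/3)" if "x \<in> X" for x
  proof -
    have "openin (top_of_set X) (X \<inter> ball x (\<delta>/3))" "x \<in> X \<inter> ball x (\<delta>/3)"
      using that \<open>\<delta> > 0\<close> by (auto simp: openin_open_Int)
    then obtain u where "openin (top_of_set X) u" "connected u" "x \<in> u" "u \<subseteq> X \<inter> ball x (\<delta>/3)"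
      using X(2) unfolding locally_connected by meson
    then show ?thesis
      unfolding openin_open by blast
  qed
  then obtain T where T: "\<And>x. x \<in> X \<Longrightarrow> open (T x)" "\<And>x. x \<in> X \<Longrightarrow> x \<in> T x"
    "\<And>x. x \<in> X \<Longrightarrow> connected (X \<inter> T x)" "\<And>x. x \<in> X \<Longrightarrow> X \<inter> T x \<subseteq> ball x (\<delta>/3)"
    by metis
  obtain D where D: "D \<subseteq> X" "finite D" "X \<subseteq> (\<Union>x\<in>D. T x)"
    using compactE_image[OF X(1), of X T] T by blast
  show ?thesis
  proof (rule that[of "(\<lambda>x. closure (X \<inter> T x)) ` D"])
    show "X \<subseteq> \<Union>((\<lambda>x. closure (X \<inter> T x)) ` D)"
    proof
      fix z assume "z \<in> X"
      then obtain x where x: "x \<in> D" "z \<in> X \<inter> T x"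
        using D by blast
      show "z \<in> \<Union>((\<lambda>x. closure (X \<inter> T x)) ` D)"
        using x(1) subsetD[OF closure_subset x(2)] by (rule UN_I)
    qed
    fix P
    assume "P \<in> (\<lambda>x. closure (X \<inter> T x)) ` D"
    then obtain x where x: "x \<in> X" and P: "P = closure (X \<inter> T x)"
      using D by blast
    have "P \<subseteq> X"
      using X P by (simp add: closure_minimal compact_imp_closed)
    moreover have "compact P"
      using X \<open>P \<subseteq> X\<close> P by (metis closed_closure compact_Int_closed inf.absorb_iff2)
    moreover have "P \<subseteq> cball x (\<delta>/3)"
      using T(4)[OF x] ball_subset_cball unfolding P by (intro closure_minimal) auto
    then have "dist u v < \<delta>" if "u \<in> P" "v \<in> P" for u v
    proof -
      have "dist x u \<le> \<delta>/3" "dist x v \<le> \<delta>/3"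
        using \<open>P \<subseteq> cball x (\<delta>/3)\<close> that by auto
      then show ?thesis
        using \<open>\<delta> > 0\<close> dist_triangle3[of u v x] by linarith
    qed
    moreover have "connected P"
      using T(3)[OF x] P by (simp add: connected_imp_connected_closure)
    ultimately show "P \<subseteq> X \<and> compact P \<and> connected P \<and> (\<forall>u\<in>P. \<forall>v\<in>P. dist u v < \<delta>)"
      by blast
  qed (use D in auto)
qed

lemma continuous_on_Max_atMost:
  fixes h :: "nat \<Rightarrow> 'a::topological_space \<Rightarrow> real"
  assumes "\<And>i. continuous_on S (h i)"
  shows "continuous_on S (\<lambda>z. Max ((\<lambda>i. h i z) ` {..n}))"
proof (induction n)
  case (Suc n)
  have "Max ((\<lambda>i. h i z) ` {..Suc n}) = max (h (Suc n) z) (Max ((\<lambda>i. h i z) ` {..n}))" for z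
    by (simp add: atMost_Suc)
  then show ?case
    using Suc assms by (simp add: continuous_on_max)
qed (use assms in simp)

section \<open>Integer iterates of a homeomorphism\<close>

locale homeo_iterates =
  fixes X :: "'a::metric_space set" and f :: "'a \<Rightarrow> 'a"
  assumes homeo: "homeomorphism X X f (inv_into X f)"
begin

lemma zit_in: "x \<in> X \<Longrightarrow> zit X f j x \<in> X"
proof -
  have "(f ^^ n) x \<in> X" if "x \<in> X" for n x
    using homeo that by (induction n) (auto simp: homeomorphism_def)
  moreover have "(inv_into X f ^^ n) x \<in> X" if "x \<in> X" for n x
    using homeo that by (induction n) (auto simp: homeomorphism_def)
  ultimately show "zit X f j x \<in> X" if "x \<in> X"
    using that by (simp add: zit_def)
qed

lemma continuous_on_zit: "continuous_on X (zit X f j)"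
proof -
  have "continuous_on X (g ^^ n)" if "continuous_on X g" "g ` X \<subseteq> X" for g :: "'a \<Rightarrow> 'a" and n
  proof (induction n)
    case (Suc n)
    have "(g ^^ n) ` X \<subseteq> X"
      using that(2) by (induction n) auto
    then show ?case
      using continuous_on_compose[OF Suc continuous_on_subset[OF that(1)]] by simp
  qed (simp add: id_def)
  then show ?thesis
    using homeo by (auto simp: zit_def homeomorphism_def)
qed

lemma zit_of_nat: "zit X f (int n) x = (f ^^ n) x"
  by (simp add: zit_def)

lemma zit_0 [simp]: "zit X f 0 x = x"
  by (simp add: zit_def)

lemma zit_plus_1:
  assumes "x \<in> X"
  shows "zit X f (j + 1) x = f (zit X f j x)"
proof (cases "j \<ge> 0")
  case True
  then show ?thesis
    by (simp add: zit_def nat_add_distrib)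
next
  case False
  define k where "k = nat (- (j + 1))"
  have k: "nat (- j) = Suc k" "j + 1 = - int k"
    using False by (auto simp: k_def)
  \<comment> \<open>For \<open>k = 0\<close> the nonnegative branch of \<open>zit\<close> applies,
    hence the case distinction.\<close>
  have "zit X f (- int k) x = (inv_into X f ^^ k) x"
    by (cases "k = 0") (simp_all add: zit_def)
  moreover have "f (inv_into X f ((inv_into X f ^^ k) x)) = (inv_into X f ^^ k) x"
    using homeo zit_in[OF assms, of "- int k"] calculation by (auto simp: homeomorphism_def)
  ultimately show ?thesis
    using False k by (simp add: zit_def)
qed

lemma zit_minus_1:
  assumes "x \<in> X"
  shows "zit X f (j - 1) x = inv_into X f (zit X f j x)"
  using zit_plus_1[OF assms, of "j - 1"]
    homeomorphism_apply1[OF homeo zit_in[OF assms, of "j - 1"]] by simp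

lemma zit_add:
  assumes "x \<in> X"
  shows "zit X f (i + j) x = zit X f i (zit X f j x)"
proof (induction i rule: int_induct[where k = 0])
  case (step1 i)
  then show ?case
    using zit_plus_1[OF assms, of "i + j"] zit_plus_1[OF zit_in[OF assms], of i j]
    by (simp add: algebra_simps)
next
  case (step2 i)
  then show ?case
    using zit_minus_1[OF assms, of "i + j"] zit_minus_1[OF zit_in[OF assms], of i j]
    by (simp add: algebra_simps)
qed simp

text \<open>Halving the expansivity constant replaces diameters by distances to a base point: if
  every iterate of \<open>C\<close> stays within \<open>\<alpha>/2\<close> of that of
  \<open>a\<close>, all diameters, and so their supremum, are at most
  \<open>\<alpha>\<close>.\<close>

lemma cw_expansive_no_small:
  assumes "cw_expansive X f"
  obtains c where "c > 0"
    "\<And>C a b. \<lbrakk>C \<subseteq> X; compact C; connected C; a \<in> C; b \<in> C; a \<noteq> b;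
      \<And>j z. z \<in> C \<Longrightarrow> dist (zit X f j a) (zit X f j z) \<le> c\<rbrakk> \<Longrightarrow> False"
proof -
  obtain \<alpha> where "\<alpha> > 0" and \<alpha>: "\<forall>C. C \<subseteq> X \<and> compact C \<and> connected C \<and> (\<exists>x\<in>C. \<exists>y\<in>C. x \<noteq> y)
      \<longrightarrow> \<alpha> < (SUP n\<in>UNIV. diameter (zit X f n ` C))"
    using assms unfolding cw_expansive_def by blast
  show ?thesis
  proof (rule that[of "\<alpha> / 2"])
    fix C a b
    assume C: "C \<subseteq> X" "compact C" "connected C" "a \<in> C" "b \<in> C" "a \<noteq> b"
      and small: "\<And>j z. z \<in> C \<Longrightarrow> dist (zit X f j a) (zit X f j z) \<le> \<alpha> / 2"
    have "diameter (zit X f j ` C) \<le> \<alpha>" for j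
    proof -
      have "dist (zit X f j y) (zit X f j z) \<le> \<alpha>" if "y \<in> C" "z \<in> C" for y z
        using small[OF that(1), of j] small[OF that(2), of j]
          dist_triangle3[of "zit X f j y" "zit X f j z" "zit X f j a"] by linarith
      then show ?thesis
        using C unfolding diameter_def by (auto intro!: cSUP_least)
    qed
    then have "(SUP n\<in>UNIV. diameter (zit X f n ` C)) \<le> \<alpha>"
      by (intro cSUP_least) auto
    then show False
      using spec[OF \<alpha>, of C] C by (meson leD)
  qed (use \<open>\<alpha> > 0\<close> in simp)
qed

section \<open>Exclusion of weak sinks\<close>

lemma no_weak_sink:
  assumes X: "compact X" "connected X" "locally connected X" "u \<in> X" "v \<in> X" "u \<noteq> v"
    and cw: "cw_expansive X f"
  shows "\<not> weak_sink X f x"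
proof
  assume sink: "weak_sink X f x"
  then have "x \<in> X"
    by (simp add: weak_sink_def)
  obtain c where "c > 0" and no_small:
    "\<And>C a b. \<lbrakk>C \<subseteq> X; compact C; connected C; a \<in> C; b \<in> C; a \<noteq> b;
      \<And>j z. z \<in> C \<Longrightarrow> dist (zit X f j a) (zit X f j z) \<le> c\<rbrakk> \<Longrightarrow> False"
    using cw_expansive_no_small[OF cw] by metis
  have sep: "\<exists>N::nat. \<forall>C a b. C \<subseteq> X \<and> connected C \<and> a \<in> C \<and> b \<in> C \<and> \<gamma> \<le> dist a b \<longrightarrow>
      (\<exists>j. \<exists>z\<in>C. \<bar>j\<bar> \<le> int N \<and> c < dist (zit X f j a) (zit X f j z))" if "\<gamma> > 0" for \<gamma>
    using X(1) continuous_on_zit no_small that by (rule separation_times_bounded)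

  \<comment> \<open>The radius \<open>c/2\<close> about the orbit of \<open>x\<close> makes any two
    points near \<open>x\<close> stay \<open>c\<close>-close in the future.\<close>
  have "nbhd_in X (local_stable_set X f (c/2) x) x"
    using sink[unfolded weak_sink_def, THEN conjunct2, rule_format, of "c/2"] \<open>c > 0\<close> by simp
  then obtain U where U: "openin (top_of_set X) U" "x \<in> U" "U \<subseteq> local_stable_set X f (c/2) x"
    unfolding nbhd_in_def by blast
  then obtain r where "r > 0" "ball x r \<inter> X \<subseteq> U"
    unfolding openin_contains_ball by blast
  then have r: "X \<inter> ball x r \<subseteq> local_stable_set X f (c/2) x"
    using U by blast
  have stable: "dist (zit X f j y) (zit X f j z) \<le> c"
    if "j \<ge> 0" "y \<in> X \<inter> ball x r" "z \<in> X \<inter> ball x r" for j y z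
  proof -
    have "dist (zit X f j x) (zit X f j w) \<le> c/2" if "w \<in> X \<inter> ball x r" for w
      using r that \<open>j \<ge> 0\<close> zit_of_nat[of "nat j"] by (force simp: local_stable_set_def)
    from this[OF that(2)] this[OF that(3)] show ?thesis
      using dist_triangle3[of "zit X f j y" "zit X f j z" "zit X f j x"] by linarith
  qed

  \<comment> \<open>\<open>M\<close> belongs to the gap \<open>c\<close>, which appears only at the
    end of the argument; it is fixed now because the size of the pieces depends on it.\<close>
  obtain M where M: "\<And>C a b. \<lbrakk>C \<subseteq> X; connected C; a \<in> C; b \<in> C; c \<le> dist a b\<rbrakk> \<Longrightarrow>
      \<exists>j. \<exists>z\<in>C. \<bar>j\<bar> \<le> int M \<and> c < dist (zit X f j a) (zit X f j z)"
    using sep[OF \<open>c > 0\<close>] by blast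

  have "\<exists>d>0. \<forall>y\<in>X. \<forall>z\<in>X. dist y z < d \<longrightarrow> dist (zit X f (int j) y) (zit X f (int j) z) < c" for j
    using compact_uniformly_continuous[OF continuous_on_zit X(1)] \<open>c > 0\<close>
    unfolding uniformly_continuous_on_def by metis
  then obtain d where d: "\<And>j. d j > 0" "\<And>j y z. \<lbrakk>y \<in> X; z \<in> X; dist y z < d j\<rbrakk>
      \<Longrightarrow> dist (zit X f (int j) y) (zit X f (int j) z) < c"
    by metis
  \<comment> \<open>By uniform continuity, points less than \<open>\<delta>\<close> apart stay less
    than \<open>c\<close> apart for \<open>M\<close> forward steps.\<close>
  define \<delta> where "\<delta> = Min (d ` {..M})"
  have "\<delta> > 0" and \<delta>: "\<And>j. j \<le> M \<Longrightarrow> \<delta> \<le> d j"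
    using d by (auto simp: \<delta>_def)
  obtain \<P> where \<P>: "finite \<P>" "X \<subseteq> \<Union>\<P>"
    "\<And>P. P \<in> \<P> \<Longrightarrow> P \<subseteq> X \<and> compact P \<and> connected P \<and> (\<forall>u\<in>P. \<forall>v\<in>P. dist u v < \<delta>)"
    using locally_connected_compact_finite_cover[OF X(1,3) \<open>\<delta> > 0\<close>] by metis

  \<comment> \<open>A connected set with two points has no isolated points.\<close>
  have "infinite (X \<inter> ball x (r/2))"
  proof (rule infinite_openin)
    show "openin (top_of_set X) (X \<inter> ball x (r/2))"
      by (simp add: openin_open_Int)
    show "x islimpt X"
      using X \<open>x \<in> X\<close> by (intro connected_imp_perfect) auto
  qed (use \<open>x \<in> X\<close> \<open>r > 0\<close> in auto)
  then obtain Y where Y: "finite Y" "card Y = Suc (card \<P>)" "Y \<subseteq> X \<inter> ball x (r/2)"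
    using infinite_arbitrarily_large by metis
  \<comment> \<open>\<open>\<gamma>\<close> is at most every gap in \<open>Y\<close>, and also at
    most \<open>r/2\<close>, so that a \<open>\<gamma>\<close>-neighbourhood of a point of
    \<open>Y\<close> stays in \<open>ball x r\<close>.\<close>
  define \<gamma> where "\<gamma> = Min (insert (r/2) ((\<lambda>(y, z). dist y z) ` (Y \<times> Y - Id)))"
  have "\<gamma> > 0"
    using Y \<open>r > 0\<close> by (auto simp: \<gamma>_def)
  have "\<gamma> \<le> r/2"
    unfolding \<gamma>_def using Y by (intro Min_le) auto
  have \<gamma>: "\<gamma> \<le> dist y z" if "y \<in> Y" "z \<in> Y" "y \<noteq> z" for y z
    unfolding \<gamma>_def using Y that by (intro Min_le) force+
  obtain N where N: "\<And>C a b. \<lbrakk>C \<subseteq> X; connected C; a \<in> C; b \<in> C; \<gamma> \<le> dist a b\<rbrakk> \<Longrightarrow>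
      \<exists>j. \<exists>z\<in>C. \<bar>j\<bar> \<le> int N \<and> c < dist (zit X f j a) (zit X f j z)"
    using sep[OF \<open>\<gamma> > 0\<close>] by blast
  \<comment> \<open>\<open>n \<ge> N\<close> makes the times from \<open>-n\<close> to
    \<open>0\<close> cover the past half of the window given by \<open>N\<close>.\<close>
  define n where "n = max N M"

  have "\<exists>P\<in>\<P>. zit X f (- int n) y \<in> P" if "y \<in> Y" for y
  proof -
    have "zit X f (- int n) y \<in> X"
      using Y(3) that by (intro zit_in) auto
    then show ?thesis
      using \<P>(2) by auto
  qed
  then obtain p where p: "\<And>y. y \<in> Y \<Longrightarrow> p y \<in> \<P> \<and> zit X f (- int n) y \<in> p y"
    by metis
  have "card (p ` Y) \<le> card \<P>"
    using p \<P> by (intro card_mono) auto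
  then have "\<not> inj_on p Y"
    using Y by (intro pigeonhole) simp
  then obtain y y' where y: "y \<in> Y" "y' \<in> Y" "y \<noteq> y'" "p y = p y'"
    unfolding inj_on_def by blast
  define P where "P = p y"
  have P: "P \<subseteq> X" "compact P" "connected P" "\<And>u v. \<lbrakk>u \<in> P; v \<in> P\<rbrakk> \<Longrightarrow> dist u v < \<delta>"
    and yP: "zit X f (- int n) y \<in> P" "zit X f (- int n) y' \<in> P"
    using \<P>(3)[of P] p[of y] p[of y'] y by (auto simp: P_def)
  have yX: "y \<in> X" "y' \<in> X"
    using y Y by auto
  define Q where "Q = zit X f (int n) ` P"
  have "continuous_on P (zit X f (int n))"
    using continuous_on_zit P continuous_on_subset by blast
  then have Q: "compact Q" "connected Q"
    using P by (simp_all add: Q_def compact_continuous_image connected_continuous_image)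
  have QX: "Q \<subseteq> X"
    using P zit_in by (auto simp: Q_def)
  have yQ: "y \<in> Q" "y' \<in> Q"
    using zit_add[OF yX(1), of "int n" "- int n"] zit_add[OF yX(2), of "int n" "- int n"] yP
    by (auto simp: Q_def image_iff)
  have QP: "zit X f (- int n) z \<in> P" if z: "z \<in> Q" for z
  proof -
    obtain w where "w \<in> P" "z = zit X f (int n) w"
      using z unfolding Q_def by blast
    then show ?thesis
      using zit_add[of w "- int n" "int n"] P(1) by auto
  qed
  \<comment> \<open>At time \<open>-n\<close> both points lie in the small piece \<open>P\<close>;
    time \<open>-i\<close> comes fewer than \<open>M\<close> steps later. The strict bound is what
    later rules out the value \<open>c\<close>.\<close>
  have late: "dist (zit X f (- int i) y) (zit X f (- int i) z) < c"
    if "z \<in> Q" "i \<le> n" "n < i + M" for i z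
  proof -
    have "dist (zit X f (- int n) y) (zit X f (- int n) z) < d (n - i)"
      using P(4)[OF yP(1) QP[OF that(1)]] \<delta>[of "n - i"] that by linarith
    moreover have zX: "z \<in> X"
      using that QX by blast
    ultimately have "dist (zit X f (int (n - i)) (zit X f (- int n) y))
        (zit X f (int (n - i)) (zit X f (- int n) z)) < c"
      using yX by (intro d(2) zit_in)
    moreover have "int (n - i) + - int n = - int i"
      using that by simp
    ultimately show ?thesis
      using zit_add[OF yX(1), of "int (n - i)" "- int n"] zit_add[OF zX, of "int (n - i)" "- int n"]
      by simp
  qed

  \<comment> \<open>First cut: bump by the distance from \<open>y\<close>, with \<open>y'\<close> as
    the point at distance at least \<open>\<gamma>\<close>.\<close>
  obtain A a where A: "A \<subseteq> Q" "compact A" "connected A" "y \<in> A" "a \<in> A" "dist y a = \<gamma>"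
    "\<And>z. z \<in> A \<Longrightarrow> dist y z \<le> \<gamma>"
  proof (rule continuum_bumping[OF Q, of "dist y" y \<gamma> y'])
    show "continuous_on Q (dist y)"
      by (intro continuous_intros)
  qed (use yQ \<gamma>[of y y'] y \<open>\<gamma> > 0\<close> in auto)
  have A_ball: "z \<in> X \<inter> ball x r" if "z \<in> A" for z
  proof -
    have "dist x y < r/2"
      using y Y by auto
    then show ?thesis
      using A(1) A(7)[OF that] that QX \<open>\<gamma> \<le> r/2\<close> dist_triangle[of x z y] by auto
  qed
  \<comment> \<open>The largest distance between the orbits of \<open>y\<close> and \<open>z\<close>
    over the times from \<open>-n\<close> to \<open>0\<close>.\<close>
  define \<phi> where "\<phi> z = Max ((\<lambda>i. dist (zit X f (- int i) y) (zit X f (- int i) z)) ` {..n})" for z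
  have \<phi>_le: "\<phi> z \<le> c \<longleftrightarrow> (\<forall>i\<le>n. dist (zit X f (- int i) y) (zit X f (- int i) z) \<le> c)" for z
    by (subst \<phi>_def, subst Max_le_iff) auto
  \<comment> \<open>Otherwise \<open>A\<close> stays \<open>c\<close>-close to \<open>y\<close> for
    \<open>N\<close> steps both ways, the future being controlled by \<open>stable\<close>, although
    it contains \<open>a\<close> at distance \<open>\<gamma>\<close>.\<close>
  have "\<exists>b\<in>A. c \<le> \<phi> b"
  proof (rule ccontr)
    assume "\<not> (\<exists>b\<in>A. c \<le> \<phi> b)"
    then have "\<forall>z\<in>A. \<phi> z \<le> c"
      by force
    then have "dist (zit X f j y) (zit X f j z) \<le> c" if "\<bar>j\<bar> \<le> int N" "z \<in> A" for j z
    proof (cases "j \<ge> 0")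
      case True
      then show ?thesis
        by (intro stable A_ball A(4) that(2))
    next
      case False
      then have "j = - int (nat (- j))" "nat (- j) \<le> n"
        using that by (auto simp: n_def)
      then show ?thesis
        using \<open>\<forall>z\<in>A. \<phi> z \<le> c\<close> \<phi>_le that by metis
    qed
    then show False
      using N[OF _ A(3-5)] A(1,6) QX by (metis not_less order_refl order_trans)
  qed
  then obtain b where "b \<in> A" "c \<le> \<phi> b"
    by blast
  have AX: "A \<subseteq> X"
    using A QX by blast
  have "continuous_on A (\<lambda>z. dist (zit X f (- int i) y) (zit X f (- int i) z))" for i
    by (intro continuous_on_dist continuous_on_const continuous_on_subset[OF continuous_on_zit AX])
  then have "continuous_on A \<phi>"
    unfolding \<phi>_def by (rule continuous_on_Max_atMost)
  moreover have "\<phi> y \<le> c"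
    using \<open>c > 0\<close> by (simp add: \<phi>_le)
  \<comment> \<open>Second cut: bump by \<open>\<phi>\<close> at level \<open>c\<close>, so that the
    threshold is attained at \<open>z\<close> and never exceeded on \<open>A'\<close>.\<close>
  ultimately obtain A' z where A': "A' \<subseteq> A" "connected A'" "y \<in> A'" "z \<in> A'" "\<phi> z = c"
    "\<And>z. z \<in> A' \<Longrightarrow> \<phi> z \<le> c"
    using continuum_bumping[OF A(2,3), of \<phi> y c b] A(4) \<open>b \<in> A\<close> \<open>c \<le> \<phi> b\<close> by metis
  have "\<phi> z \<in> (\<lambda>i. dist (zit X f (- int i) y) (zit X f (- int i) z)) ` {..n}"
    unfolding \<phi>_def by (intro Max_in) auto
  then obtain i where i: "i \<le> n" "dist (zit X f (- int i) y) (zit X f (- int i) z) = c"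
    using A' by auto
  \<comment> \<open>Attaining exactly \<open>c\<close> contradicts \<open>late\<close> if
    \<open>-i\<close> is within fewer than \<open>M\<close> steps of \<open>-n\<close>.\<close>
  have "i + M \<le> n"
    using late[of z i] i A' A by force
  \<comment> \<open>\<open>?D\<close> contains two points \<open>c\<close> apart, so
    \<open>M\<close> forces a separation beyond \<open>c\<close> at some \<open>j\<close> with
    \<open>\<bar>j\<bar> \<le> M\<close>. But \<open>j - i\<close> is either nonnegative, where
    \<open>stable\<close> applies, or at least \<open>-n\<close>, where
    \<open>\<phi> \<le> c\<close> applies.\<close>
  let ?D = "zit X f (- int i) ` A'"
  have "dist (zit X f j (zit X f (- int i) y)) (zit X f j w) \<le> c"
    if j: "\<bar>j\<bar> \<le> int M" and w: "w \<in> ?D" for j w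
  proof -
    obtain w' where w': "w' \<in> A'" "w = zit X f (- int i) w'"
      using w by blast
    have "dist (zit X f (j - int i) y) (zit X f (j - int i) w') \<le> c"
    proof (cases "j \<ge> int i")
      case True
      then show ?thesis
        by (intro stable A_ball subsetD[OF A'(1)] A'(3) w'(1)) simp
    next
      case False
      then have "j - int i = - int (nat (int i - j))" "nat (int i - j) \<le> n"
        using j \<open>i + M \<le> n\<close> by auto
      then show ?thesis
        using A'(6)[OF w'(1)] \<phi>_le by metis
    qed
    then show ?thesis
      using zit_add[OF yX(1), of j "- int i"] zit_add[of w' j "- int i"] w' A' AX by auto
  qed
  moreover have "connected ?D"
    using A' AX continuous_on_zit
    by (meson connected_continuous_image continuous_on_subset order_trans)
  moreover have "?D \<subseteq> X"
    using A' AX zit_in by blast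
  ultimately show False
    using M[of ?D, OF _ _ imageI[OF A'(3)] imageI[OF A'(4)]] i(2) by (metis not_less order_refl)
qed

end

theorem theorem2:
  fixes X :: "'a::metric_space set" and f :: "'a \<Rightarrow> 'a"
  assumes "peano_continuum X"
    and "homeomorphism X X f (inv_into X f)"
    and "cw_expansive X f"
  shows "\<not> (\<exists>x\<in>X. weak_sink X f x)"
proof -
  interpret homeo_iterates X f
    using assms(2) by unfold_locales
  show ?thesis
    using assms(1,3) no_weak_sink unfolding peano_continuum_def by blast
qed

end
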